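(* A saturated subspace of a quasisober space is not always quasisober: there exist a quasisober space $X$ and a saturated subset $U\subseteq X$ such that $U$ with the subspace topology is not quasisober.
   Context: For a topological space $X$, the specialization preorder is $x\le y$ iff $x\in\mathrm{cl}\{y\}$; all order-theoretic notions in $X$ refer to it (for a subspace, to the specialization preorder of the subspace, with bounds taken inside the subspace). For $A\subseteq X$, $A^{\uparrow}$ and $A^{\downarrow}$ denote the sets of all upper, respectively lower, bounds of $A$ in $X$, and $A^{\delta}=(A^{\uparrow})^{\downarrow}$ is the cut closure of $A$. Directed sets and irreducible closed sets are nonempty. $X$ is quasisober if it is $T_0$ and every irreducible closed subset of $X$ equals $D^{\delta}$ for some directed subset $D$ of $X$. A subset is saturated if it is an intersection of open sets, equivalently an upper set for the specialization order. *)

theory Defs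
  imports "HOL-Analysis.Analysis"
begin

definition spec_le :: "'a topology \<Rightarrow> 'a \<Rightarrow> 'a \<Rightarrow> bool" where
  "spec_le X x y \<longleftrightarrow> x \<in> topspace X \<and> y \<in> topspace X \<and> x \<in> X closure_of {y}"

definition upper_bounds :: "'a topology \<Rightarrow> 'a set \<Rightarrow> 'a set" where
  "upper_bounds X A = {u \<in> topspace X. \<forall>a\<in>A. spec_le X a u}"

definition lower_bounds :: "'a topology \<Rightarrow> 'a set \<Rightarrow> 'a set" where
  "lower_bounds X A = {l \<in> topspace X. \<forall>a\<in>A. spec_le X l a}"

definition cut_closure :: "'a topology \<Rightarrow> 'a set \<Rightarrow> 'a set" where
  "cut_closure X A = lower_bounds X (upper_bounds X A)"

definition directed_in :: "'a topology \<Rightarrow> 'a set \<Rightarrow> bool" where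
  "directed_in X D \<longleftrightarrow> D \<subseteq> topspace X \<and> D \<noteq> {} \<and>
     (\<forall>x\<in>D. \<forall>y\<in>D. \<exists>z\<in>D. spec_le X x z \<and> spec_le X y z)"

definition irreducible_closed_in :: "'a topology \<Rightarrow> 'a set \<Rightarrow> bool" where
  "irreducible_closed_in X C \<longleftrightarrow> closedin X C \<and> C \<noteq> {} \<and>
     (\<forall>A B. closedin X A \<and> closedin X B \<and> C = A \<union> B \<longrightarrow> C = A \<or> C = B)"

definition quasisober :: "'a topology \<Rightarrow> bool" where
  "quasisober X \<longleftrightarrow> t0_space X \<and>
     (\<forall>C. irreducible_closed_in X C \<longrightarrow> (\<exists>D. directed_in X D \<and> C = cut_closure X D))"

(* The intersection is taken inside the space, so the empty family yields the whole space. *)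
definition saturated_in :: "'a topology \<Rightarrow> 'a set \<Rightarrow> bool" where
  "saturated_in X U \<longleftrightarrow>
     (\<exists>\<F>. (\<forall>V\<in>\<F>. openin X V) \<and> U = topspace X \<inter> \<Inter>\<F>)"

end

theory Submission
  imports Defs
begin

text \<open>The space consists of an infinite chain \<open>D\<close> without upper bounds and an infinite antichain
  \<open>U\<close> that is order-theoretically disjoint from \<open>D\<close>; its proper closed sets are the finite lower
  sets. The only irreducible closed set that is not a point closure is the whole space, and it is
  the cut closure of \<open>D\<close>, as \<open>D\<close> has no upper bound. Passing to the saturated set \<open>U\<close> removes
  \<open>D\<close>: there remains an infinite set with the cofinite topology, which is irreducible, while its
  directed subsets are singletons.\<close>

text \<open>The even numbers form the chain, the odd numbers the antichain.\<close>

definition chain_le :: "nat \<Rightarrow> nat \<Rightarrow> bool" where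
  "chain_le x y \<longleftrightarrow> x = y \<or> even x \<and> even y \<and> x \<le> y"

definition chain_antichain :: "nat topology" where
  "chain_antichain =
     topology (\<lambda>V. V = {} \<or> finite (- V) \<and> (\<forall>x\<in>V. \<forall>y. chain_le x y \<longrightarrow> y \<in> V))"

lemma openin_chain_antichain:
  "openin chain_antichain V \<longleftrightarrow>
     V = {} \<or> finite (- V) \<and> (\<forall>x\<in>V. \<forall>y. chain_le x y \<longrightarrow> y \<in> V)"
proof -
  let ?P = "\<lambda>V. V = {} \<or> finite (- V) \<and> (\<forall>x\<in>V. \<forall>y. chain_le x y \<longrightarrow> y \<in> V)"
  have "?P (S \<inter> T)" if "?P S" "?P T" for S T
    using that by auto
  moreover have "?P (\<Union>\<K>)" if \<K>: "\<forall>K\<in>\<K>. ?P K" for \<K>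
  proof (cases "\<Union>\<K> = {}")
    case False
    then obtain K where K: "K \<in> \<K>" "K \<noteq> {}" by auto
    have "finite (- \<Union>\<K>)"
      by (rule finite_subset[of _ "- K"]) (use K \<K> in auto)
    moreover have "\<forall>x\<in>\<Union>\<K>. \<forall>y. chain_le x y \<longrightarrow> y \<in> \<Union>\<K>"
      using \<K> by blast
    ultimately show ?thesis by blast
  qed simp
  ultimately have "istopology ?P"
    unfolding istopology_def by blast
  then show ?thesis
    by (simp add: chain_antichain_def topology_inverse')
qed

lemma topspace_chain_antichain [simp]: "topspace chain_antichain = UNIV"
proof -
  have "openin chain_antichain UNIV"
    by (simp add: openin_chain_antichain)
  then show ?thesis
    using openin_subset by blast
qed

lemma closedin_chain_antichain:
  "closedin chain_antichain C \<longleftrightarrow>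
     C = UNIV \<or> finite C \<and> (\<forall>y\<in>C. \<forall>x. chain_le x y \<longrightarrow> x \<in> C)"
  by (auto simp: closedin_def openin_chain_antichain simp flip: Compl_eq_Diff_UNIV)

text \<open>The chain has order type omega, so principal lower sets are finite; this is what makes
  them the point closures.\<close>

lemma closedin_chain_le: "closedin chain_antichain {x. chain_le x y}"
proof -
  have "finite {x. chain_le x y}"
    by (rule finite_subset[of _ "{..y}"]) (auto simp: chain_le_def)
  then show ?thesis
    by (auto simp: closedin_chain_antichain chain_le_def)
qed

lemma spec_le_chain_antichain [simp]: "spec_le chain_antichain x y \<longleftrightarrow> chain_le x y"
proof -
  have "chain_antichain closure_of {y} = {x. chain_le x y}"
  proof (rule closure_of_unique)
    show "{y} \<subseteq> {x. chain_le x y}"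
      by (simp add: chain_le_def)
    show "{x. chain_le x y} \<subseteq> T" if "{y} \<subseteq> T" "closedin chain_antichain T" for T
      using that by (auto simp: closedin_chain_antichain)
  qed (rule closedin_chain_le)
  then show ?thesis
    by (simp add: spec_le_def)
qed

lemma t0_space_chain_antichain: "t0_space chain_antichain"
  unfolding t0_space_def
proof (intro ballI impI)
  fix x y :: nat
  assume "x \<noteq> y"
  then have "\<not> chain_le x y \<or> \<not> chain_le y x"
    by (auto simp: chain_le_def)
  \<comment> \<open>By antisymmetry one point lies outside the principal lower set of the other, and
    the complement of that set separates the two.\<close>
  moreover have "openin chain_antichain (- {x. chain_le x z})" "chain_le z z" for z
    using closedin_chain_le[of z] by (auto simp: closedin_def Compl_eq_Diff_UNIV chain_le_def)
  ultimately show "\<exists>V. openin chain_antichain V \<and> (x \<notin> V) = (y \<in> V)"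
    by (metis ComplD ComplI mem_Collect_eq)
qed

text \<open>A proper closed set is finite. If it contains a point of the antichain, that point
  splits off; otherwise it is a finite lower set of the chain and has a greatest element.\<close>

lemma irreducible_closed_in_chain_antichain:
  assumes "irreducible_closed_in chain_antichain C"
  shows "C = UNIV \<or> (\<exists>y. C = {x. chain_le x y})"
proof (cases "C = UNIV")
  case False
  have irr: "C = A \<or> C = B"
    if "closedin chain_antichain A" "closedin chain_antichain B" "C = A \<union> B" for A B
    using assms that unfolding irreducible_closed_in_def by blast
  have C: "finite C" "C \<noteq> {}" "\<And>x y. y \<in> C \<Longrightarrow> chain_le x y \<Longrightarrow> x \<in> C"
    using assms False by (auto simp: irreducible_closed_in_def closedin_chain_antichain)
  show ?thesis
  proof (cases "\<exists>c\<in>C. odd c")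
    case True
    then obtain c where c: "c \<in> C" "odd c" by blast
    \<comment> \<open>An odd number is comparable only to itself, so both isolating it and removing
      it leave a lower set.\<close>
    have "closedin chain_antichain {c}" "closedin chain_antichain (C - {c})"
      using C c by (auto simp: closedin_chain_antichain chain_le_def)
    then have "C = {c}"
      using irr[of "{c}" "C - {c}"] c by blast
    then show ?thesis
      using c by (auto simp: chain_le_def)
  next
    case False
    have "Max C \<in> C" "even (Max C)"
      using C False Max_in[of C] by auto
    then have "chain_le x (Max C) \<longleftrightarrow> x \<in> C" for x
      using C(1,3) False Max_ge[of C x] unfolding chain_le_def by blast
    then have "C = {x. chain_le x (Max C)}" by blast
    then show ?thesis by blast
  qed
qed simp

lemma cut_closure_singleton_chain_antichain:
  "cut_closure chain_antichain {y} = {x. chain_le x y}"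
proof -
  have "chain_le y y" "chain_le x y \<Longrightarrow> chain_le y z \<Longrightarrow> chain_le x z" for x z
    by (auto simp: chain_le_def)
  then show ?thesis
    unfolding cut_closure_def lower_bounds_def upper_bounds_def set_eq_iff
    by (simp, meson)
qed

text \<open>Every point is vacuously a lower bound of the empty set of upper bounds.\<close>

lemma cut_closure_even_chain_antichain: "cut_closure chain_antichain {x. even x} = UNIV"
proof -
  have "\<not> (\<forall>x. even x \<longrightarrow> chain_le x u)" for u
  proof
    assume *: "\<forall>x. even x \<longrightarrow> chain_le x u"
    \<comment> \<open>The witness is an even number exceeding \<open>u\<close>.\<close>
    have "chain_le (2 * Suc u) u"
      using * by simp
    then show False
      by (simp add: chain_le_def)
  qed
  then show ?thesis
    by (auto simp: cut_closure_def lower_bounds_def upper_bounds_def)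
qed

lemma quasisober_chain_antichain: "quasisober chain_antichain"
  unfolding quasisober_def
proof (intro conjI allI impI)
  fix C
  assume "irreducible_closed_in chain_antichain C"
  then consider "C = UNIV" | y where "C = {x. chain_le x y}"
    using irreducible_closed_in_chain_antichain by blast
  then show "\<exists>D. directed_in chain_antichain D \<and> C = cut_closure chain_antichain D"
  proof cases
    case 1
    have "directed_in chain_antichain {x. even x}"
      unfolding directed_in_def
    proof (intro conjI ballI)
      show "{x::nat. even x} \<noteq> {}" by (auto intro: exI[of _ 0])
      fix x y :: nat
      assume "x \<in> {x. even x}" "y \<in> {x. even x}"
      then show "\<exists>z\<in>{x. even x}. spec_le chain_antichain x z \<and> spec_le chain_antichain y z"
        by (intro bexI[of _ "max x y"]) (auto simp: chain_le_def max_def)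
    qed simp
    then show ?thesis
      using 1 cut_closure_even_chain_antichain by metis
  next
    case 2
    moreover have "directed_in chain_antichain {y}"
      by (simp add: directed_in_def chain_le_def)
    ultimately show ?thesis
      using cut_closure_singleton_chain_antichain by metis
  qed
qed (rule t0_space_chain_antichain)

lemma saturated_in_odd: "saturated_in chain_antichain {x. odd x}"
proof -
  \<comment> \<open>Each even number lies in its own principal lower set, while an odd number lies
    in none generated by an even number.\<close>
  let ?F = "range (\<lambda>y. - {x. chain_le x (2 * y)})"
  have "\<forall>V\<in>?F. openin chain_antichain V"
    using closedin_chain_le by (auto simp: closedin_def Compl_eq_Diff_UNIV)
  moreover have "{x. odd x} = topspace chain_antichain \<inter> \<Inter>?F"
    by (auto simp: chain_le_def elim!: evenE)
  ultimately show ?thesis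
    unfolding saturated_in_def by blast
qed

text \<open>This is the cofinite topology: odd numbers are minimal, so finite sets of them are
  already closed in the whole space.\<close>

lemma closedin_subtopology_odd:
  "closedin (subtopology chain_antichain {x. odd x}) C \<longleftrightarrow>
     C = {x. odd x} \<or> finite C \<and> C \<subseteq> {x. odd x}"
proof
  assume "closedin (subtopology chain_antichain {x. odd x}) C"
  then show "C = {x. odd x} \<or> finite C \<and> C \<subseteq> {x. odd x}"
    by (auto simp: closedin_subtopology closedin_chain_antichain)
next
  assume "C = {x. odd x} \<or> finite C \<and> C \<subseteq> {x. odd x}"
  \<comment> \<open>The set of all odd numbers is infinite and not closed in the whole space, so it
    has to arise as the trace of \<open>UNIV\<close>.\<close>
  then have "closedin chain_antichain (if C = {x. odd x} then UNIV else C)"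
    by (auto simp: closedin_chain_antichain chain_le_def)
  moreover have "C = (if C = {x. odd x} then UNIV else C) \<inter> {x. odd x}"
    using \<open>C = {x. odd x} \<or> finite C \<and> C \<subseteq> {x. odd x}\<close> by auto
  ultimately show "closedin (subtopology chain_antichain {x. odd x}) C"
    unfolding closedin_subtopology by blast
qed

lemma spec_le_subtopology_odd:
  "spec_le (subtopology chain_antichain {x. odd x}) x y \<longleftrightarrow> odd x \<and> x = y"
proof -
  have "closedin (subtopology chain_antichain {x. odd x}) {y}" if "odd y"
    using that by (simp add: closedin_subtopology_odd)
  then have "subtopology chain_antichain {x. odd x} closure_of {y} = {y}" if "odd y"
    using that closure_of_closedin by blast
  then show ?thesis
    by (auto simp: spec_le_def)
qed

lemma not_quasisober_subtopology_odd:
  "\<not> quasisober (subtopology chain_antichain {x. odd x})"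
proof
  let ?U = "subtopology chain_antichain {x. odd x}"
  assume "quasisober ?U"
  moreover have "infinite {x::nat. odd x}"
    \<comment> \<open>Of the two numbers following any bound, one is odd.\<close>
    unfolding infinite_nat_iff_unbounded by (metis mem_Collect_eq even_Suc lessI less_SucI)
  \<comment> \<open>An infinite set is not the union of two finite ones.\<close>
  then have "irreducible_closed_in ?U {x. odd x}"
    unfolding irreducible_closed_in_def closedin_subtopology_odd by (metis finite.emptyI finite_Un)
  ultimately obtain D where D: "directed_in ?U D" "{x. odd x} = cut_closure ?U D"
    unfolding quasisober_def by blast
  then obtain d where "d \<in> D" "odd d"
    by (auto simp: directed_in_def)
  \<comment> \<open>The order of the subspace is equality, so elements with a common upper bound
    coincide.\<close>
  moreover have "x = y" if "x \<in> D" "y \<in> D" for x y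
    using D(1) that unfolding directed_in_def spec_le_subtopology_odd by metis
  ultimately have d: "D = {d}" "odd d"
    by blast+
  have cut: "cut_closure ?U D = {d}"
    unfolding d(1) using d(2)
    by (auto simp: cut_closure_def lower_bounds_def upper_bounds_def spec_le_subtopology_odd)
  \<comment> \<open>A second odd number contradicts the collapse of the subspace to
    \<open>{d}\<close>.\<close>
  have "Suc (Suc d) \<in> {x. odd x}"
    using d by simp
  also have "{x. odd x} = {d}"
    using D(2) cut by (rule trans)
  finally show False by simp
qed

theorem mainTheorem4:
  shows "\<exists>(X :: nat topology) U.
           quasisober X \<and> saturated_in X U \<and> \<not> quasisober (subtopology X U)"
  using quasisober_chain_antichain saturated_in_odd not_quasisober_subtopology_odd by blast

end
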